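(* For every tree $T$, the collection $\mathcal{S}=\{[t]: t\in T\}$ of subsets of the ray space $\mathcal{R}(T)$ is hereditarily complete; that is, for every closed subspace $Y\subseteq\mathcal{R}(T)$, the collection $\{[t]\cap Y: t\in T\}$ is complete.
   Context: A tree is a partially ordered set $T$ with a unique minimal element such that the set of predecessors of any element is well-ordered (distinct limit nodes may have the same set of strict predecessors). A path in $T$ is a nonempty down-closed chain; a ray is a path without maximal element. The ray space $\mathcal{R}(T)$ is the set of all rays of $T$ with the subspace topology inherited from $2^T$ (product topology), rays being identified with their characteristic functions. For $t\in T$, $[t]=\{x\in\mathcal{R}(T): t\in x\}$. A collection of sets is centered if every nonempty finite subfamily has nonempty intersection; a collection is complete if every nonempty centered subfamily of it has nonempty intersection. *)

theory Defs
  imports "HOL-Analysis.Analysis"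
begin

text \<open>A tree is given by its carrier \<open>T\<close> and its reflexive order \<open>r\<close>, where \<open>(s, t) \<in> r\<close> means
  \<open>s \<le> t\<close>. Levels may be transfinite, and distinct limit nodes may have the same strict
  predecessors.\<close>

definition order_tree :: "'a set \<Rightarrow> 'a rel \<Rightarrow> bool" where
  "order_tree T r \<longleftrightarrow>
     partial_order_on T r \<and>
     (\<exists>!m. m \<in> T \<and> (\<forall>s\<in>T. (s, m) \<in> r \<longrightarrow> s = m)) \<and>
     (\<forall>t\<in>T. well_order_on (underS r t) (Restr r (underS r t)))"

definition tree_paths :: "'a set \<Rightarrow> 'a rel \<Rightarrow> 'a set set" where
  "tree_paths T r =
     {x. x \<subseteq> T \<and> x \<noteq> {} \<and> x \<in> Chains r \<and> (\<forall>t\<in>x. \<forall>s\<in>T. (s, t) \<in> r \<longrightarrow> s \<in> x)}"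

definition tree_rays :: "'a set \<Rightarrow> 'a rel \<Rightarrow> 'a set set" where
  "tree_rays T r =
     {x \<in> tree_paths T r. \<not> (\<exists>m\<in>x. \<forall>s\<in>x. (m, s) \<in> r \<longrightarrow> s = m)}"

text \<open>The space \<open>2\<^sup>T\<close> is the product of \<open>T\<close> copies of the discrete space \<^typ>\<open>bool\<close>. Since the
  points of a \<^const>\<open>product_topology\<close> are extensional functions, characteristic functions are
  restricted to \<open>T\<close>. Pulling back along this injection is the subspace topology on the rays.\<close>

definition ray_space :: "'a set \<Rightarrow> 'a rel \<Rightarrow> 'a set topology" where
  "ray_space T r =
     pullback_topology (tree_rays T r) (\<lambda>x. \<lambda>t\<in>T. t \<in> x)
       (product_topology (\<lambda>_. discrete_topology (UNIV :: bool set)) T)"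

lemma topspace_ray_space [simp]: "topspace (ray_space T r) = tree_rays T r"
  by (auto simp: ray_space_def topspace_pullback_topology)

definition rays_through :: "'a set \<Rightarrow> 'a rel \<Rightarrow> 'a \<Rightarrow> 'a set set" where
  "rays_through T r t = {x \<in> tree_rays T r. t \<in> x}"

definition centered :: "'b set set \<Rightarrow> bool" where
  "centered \<F> \<longleftrightarrow> (\<forall>\<G>. \<G> \<subseteq> \<F> \<and> finite \<G> \<and> \<G> \<noteq> {} \<longrightarrow> \<Inter>\<G> \<noteq> {})"

definition complete_collection :: "'b set set \<Rightarrow> bool" where
  "complete_collection \<C> \<longleftrightarrow>
     (\<forall>\<F>. \<F> \<subseteq> \<C> \<and> \<F> \<noteq> {} \<and> centered \<F> \<longrightarrow> \<Inter>\<F> \<noteq> {})"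

definition hereditarily_complete :: "'b topology \<Rightarrow> 'b set set \<Rightarrow> bool" where
  "hereditarily_complete X \<S> \<longleftrightarrow>
     (\<forall>Y. closedin X Y \<longrightarrow> complete_collection {S \<inter> Y | S. S \<in> \<S>})"

end

theory Submission
  imports Defs
begin

text \<open>Let \<open>A\<close> be the set of nodes \<open>t\<close> for which \<open>[t] \<inter> Y\<close> lies in the centered family, and let
  \<open>x\<close> be the down-closure of \<open>A\<close>, which is a path. If \<open>x\<close> has a maximal element, that
  element is in \<open>A\<close>, and every ray of \<open>Y\<close> through it contains \<open>A\<close>. Otherwise \<open>x\<close> is a ray. If no
  ray of \<open>Y\<close> contains \<open>A\<close>, then \<open>x\<close> can be approximated by rays of \<open>Y\<close>, so that \<open>x \<in> Y\<close>, a
  contradiction: on finitely many nodes, \<open>x\<close> agrees with any ray of \<open>Y\<close> through suitable finitely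
  many elements of \<open>A\<close>.\<close>

text \<open>A basic open set of the product restricts only finitely many coordinates, so a
  neighbourhood of \<open>x\<close> missing \<open>Y\<close> is refuted by one ray of
  \<open>Y\<close> that agrees with \<open>x\<close> there.\<close>

lemma closedin_ray_space_memI:
  assumes Y: "closedin (ray_space T r) Y" and x: "x \<in> tree_rays T r"
    and approx: "\<And>K. finite K \<Longrightarrow> K \<subseteq> T \<Longrightarrow> \<exists>y\<in>Y. \<forall>k\<in>K. k \<in> y \<longleftrightarrow> k \<in> x"
  shows "x \<in> Y"
proof (rule ccontr)
  assume "x \<notin> Y"
  let ?P = "product_topology (\<lambda>_. discrete_topology (UNIV :: bool set)) T"
  let ?f = "\<lambda>x. \<lambda>t\<in>T. t \<in> x"
  have YR: "Y \<subseteq> tree_rays T r"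
    using closedin_subset[OF Y] by simp
  have "openin (ray_space T r) (tree_rays T r - Y)"
    using Y by (simp add: closedin_def)
  then obtain U where U: "openin ?P U" "tree_rays T r - Y = ?f -` U \<inter> tree_rays T r"
    unfolding ray_space_def openin_pullback_topology by blast
  have "?f x \<in> U"
    using x \<open>x \<notin> Y\<close> U(2) by blast
  then obtain V where fin: "finite {i \<in> T. V i \<noteq> (UNIV :: bool set)}"
    and V: "?f x \<in> Pi\<^sub>E T V" "Pi\<^sub>E T V \<subseteq> U"
    using U(1) unfolding openin_product_topology_alt by auto
  obtain y where y: "y \<in> Y" "\<forall>k\<in>{i \<in> T. V i \<noteq> UNIV}. k \<in> y \<longleftrightarrow> k \<in> x"
    using approx[OF fin] by blast
  have "(t \<in> y) \<in> V t" if "t \<in> T" for t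
    using that y(2) V(1) by (cases "V t = UNIV") (auto simp: PiE_iff)
  then have "?f y \<in> U"
    using V(2) by (auto simp: PiE_iff)
  then show False
    using y(1) YR U(2) by blast
qed

lemma tree_path_down_closed:
  "y \<in> tree_paths T r \<Longrightarrow> t \<in> y \<Longrightarrow> s \<in> T \<Longrightarrow> (s, t) \<in> r \<Longrightarrow> s \<in> y"
  by (auto simp: tree_paths_def)

lemma tree_path_comparable:
  "y \<in> tree_paths T r \<Longrightarrow> s \<in> y \<Longrightarrow> t \<in> y \<Longrightarrow> (s, t) \<in> r \<or> (t, s) \<in> r"
  by (auto simp: tree_paths_def Chains_def)

lemma tree_path_subset: "y \<in> tree_paths T r \<Longrightarrow> y \<subseteq> T"
  by (auto simp: tree_paths_def)

lemma tree_rays_subset_tree_paths: "tree_rays T r \<subseteq> tree_paths T r"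
  by (auto simp: tree_rays_def)

text \<open>Two nodes of the down-closure lie below two members of \<open>A\<close>; a path through
  both members contains both nodes, which makes them comparable.\<close>

lemma down_closure_tree_path:
  assumes r: "partial_order_on T r" and "A \<subseteq> T" "A \<noteq> {}"
    and pairs: "\<And>s t. s \<in> A \<Longrightarrow> t \<in> A \<Longrightarrow> \<exists>y\<in>tree_paths T r. s \<in> y \<and> t \<in> y"
  shows "{s \<in> T. \<exists>t\<in>A. (s, t) \<in> r} \<in> tree_paths T r" (is "?x \<in> _")
proof -
  have "trans r" and refl: "\<And>t. t \<in> T \<Longrightarrow> (t, t) \<in> r"
    using r by (auto simp: partial_order_on_def preorder_on_def refl_on_def)
  have "(s, s') \<in> r \<or> (s', s) \<in> r" if s: "s \<in> ?x" and s': "s' \<in> ?x" for s s'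
  proof -
    obtain t t' where t: "t \<in> A" "(s, t) \<in> r" "t' \<in> A" "(s', t') \<in> r"
      using s s' by blast
    then obtain y where y: "y \<in> tree_paths T r" "t \<in> y" "t' \<in> y"
      using pairs by blast
    have "s \<in> y" "s' \<in> y"
      using tree_path_down_closed[OF y(1)] y t s s' by auto
    then show ?thesis
      by (rule tree_path_comparable[OF y(1)])
  qed
  then have "?x \<in> Chains r"
    by (auto simp: Chains_def)
  moreover have "?x \<noteq> {}"
    using \<open>A \<subseteq> T\<close> \<open>A \<noteq> {}\<close> refl by blast
  moreover have "\<forall>t\<in>?x. \<forall>s\<in>T. (s, t) \<in> r \<longrightarrow> s \<in> ?x"
    using transD[OF \<open>trans r\<close>] by simp metis
  ultimately show ?thesis
    by (auto simp: tree_paths_def)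
qed

text \<open>This is completeness in terms of nodes: a ray lies in \<open>[t]\<close> for every
  \<open>t \<in> A\<close> exactly when it contains \<open>A\<close>.\<close>

lemma closed_rays_meet_all:
  assumes r: "partial_order_on T r" and Y: "closedin (ray_space T r) Y"
    and A: "A \<subseteq> T" "A \<noteq> {}"
    and meet: "\<And>G. finite G \<Longrightarrow> G \<noteq> {} \<Longrightarrow> G \<subseteq> A \<Longrightarrow> \<exists>y\<in>Y. G \<subseteq> y"
  shows "\<exists>y\<in>Y. A \<subseteq> y"
proof (rule ccontr)
  assume none: "\<not> (\<exists>y\<in>Y. A \<subseteq> y)"
  have refl: "(t, t) \<in> r" if "t \<in> T" for t
    using r that by (auto simp: partial_order_on_def preorder_on_def refl_on_def)
  have Y_rays: "Y \<subseteq> tree_rays T r"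
    using closedin_subset[OF Y] by simp
  then have Y_paths: "Y \<subseteq> tree_paths T r"
    using tree_rays_subset_tree_paths by blast
  define x where "x = {s \<in> T. \<exists>t\<in>A. (s, t) \<in> r}"
  have "A \<subseteq> x"
    using A refl by (auto simp: x_def)
  have below: "s \<in> y" if "y \<in> Y" "t \<in> y" "s \<in> T" "(s, t) \<in> r" for s t y
    using tree_path_down_closed[OF subsetD[OF Y_paths]] that .
  have pairs: "\<exists>y\<in>tree_paths T r. s \<in> y \<and> t \<in> y" if "s \<in> A" "t \<in> A" for s t
    using meet[of "{s, t}"] that Y_paths by (simp; blast)
  have "x \<in> tree_paths T r"
    unfolding x_def using r A pairs by (rule down_closure_tree_path)
  moreover have "\<not> (\<exists>m\<in>x. \<forall>s\<in>x. (m, s) \<in> r \<longrightarrow> s = m)"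
  proof
    assume "\<exists>m\<in>x. \<forall>s\<in>x. (m, s) \<in> r \<longrightarrow> s = m"
    then obtain m where m: "m \<in> x" "\<And>s. s \<in> x \<Longrightarrow> (m, s) \<in> r \<Longrightarrow> s = m"
      by blast
    \<comment> \<open>Some \<open>t \<in> A\<close> lies above \<open>m\<close>; since
      \<open>t \<in> x\<close>, maximality gives \<open>t = m\<close>.\<close>
    then have "m \<in> A"
      using \<open>A \<subseteq> x\<close> by (auto simp: x_def)
    have "(t, m) \<in> r" if "t \<in> A" for t
      using tree_path_comparable[OF \<open>x \<in> tree_paths T r\<close>, of t m] m that \<open>A \<subseteq> x\<close> by blast
    moreover obtain y where "y \<in> Y" "m \<in> y"
      using meet[of "{m}"] \<open>m \<in> A\<close> by auto
    ultimately have "A \<subseteq> y"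
      using below[OF \<open>y \<in> Y\<close> \<open>m \<in> y\<close>] A(1) by blast
    then show False
      using none \<open>y \<in> Y\<close> by blast
  qed
  ultimately have "x \<in> tree_rays T r"
    by (simp add: tree_rays_def)
  with Y have "x \<in> Y"
  proof (rule closedin_ray_space_memI)
    fix K assume K: "finite K" "K \<subseteq> T"
    \<comment> \<open>The witness \<open>s k\<close> forces rays of \<open>Y\<close> through it to agree with \<open>x\<close> at \<open>k\<close>. A node above all
      of \<open>A\<close> needs none, since it lies on no ray of \<open>Y\<close>.\<close>
    have "\<exists>s\<in>A. \<forall>y\<in>Y. s \<in> y \<longrightarrow> (k \<in> y \<longleftrightarrow> k \<in> x)" if "k \<in> K" for k
    proof (cases "k \<in> x")
      case True
      then obtain s where "s \<in> A" "k \<in> T" "(k, s) \<in> r"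
        by (auto simp: x_def)
      then show ?thesis
        using True below by metis
    next
      case k: False
      show ?thesis
      proof (cases "\<forall>s\<in>A. (s, k) \<in> r")
        case True
        \<comment> \<open>A ray of \<open>Y\<close> through \<open>k\<close> would contain all of
          \<open>A\<close> by down-closure, against \<open>none\<close>. Any element of
          \<open>A\<close> is then a witness.\<close>
        then have "k \<notin> y" if "y \<in> Y" for y
          using none below[OF that] A(1) that by (meson subset_iff)
        then show ?thesis
          using A(2) k by blast
      next
        case False
        then obtain s where s: "s \<in> A" "(s, k) \<notin> r"
          by blast
        \<comment> \<open>Otherwise \<open>k\<close> would be in \<open>x\<close>. So
          \<open>k\<close> and \<open>s\<close> are incomparable and share no path.\<close>
        moreover have "(k, s) \<notin> r"
          using k s(1) that K(2) unfolding x_def by blast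
        ultimately have "k \<notin> y" if "y \<in> Y" "s \<in> y" for y
          using tree_path_comparable[OF subsetD[OF Y_paths \<open>y \<in> Y\<close>] \<open>s \<in> y\<close>] by blast
        then show ?thesis
          using k by (intro bexI[OF _ \<open>s \<in> A\<close>]) simp
      qed
    qed
    then have "\<forall>k\<in>K. \<exists>s. s \<in> A \<and> (\<forall>y\<in>Y. s \<in> y \<longrightarrow> (k \<in> y \<longleftrightarrow> k \<in> x))"
      unfolding Bex_def by (rule ballI)
    then obtain s where s: "\<forall>k\<in>K. s k \<in> A \<and> (\<forall>y\<in>Y. s k \<in> y \<longrightarrow> (k \<in> y \<longleftrightarrow> k \<in> x))"
      by (rule bchoice[THEN exE])
    \<comment> \<open>\<open>K\<close> may be empty, while \<open>meet\<close> asks for a nonempty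
      set; \<open>a\<close> provides for this.\<close>
    obtain a where "a \<in> A"
      using A(2) by blast
    then have "insert a (s ` K) \<subseteq> A"
      using s by blast
    with K(1) have "\<exists>y\<in>Y. insert a (s ` K) \<subseteq> y"
      by (intro meet) simp_all
    then obtain y where y: "y \<in> Y" "insert a (s ` K) \<subseteq> y"
      by blast
    have "k \<in> y \<longleftrightarrow> k \<in> x" if "k \<in> K" for k
      using bspec[OF s that] y that by blast
    then show "\<exists>y\<in>Y. \<forall>k\<in>K. k \<in> y \<longleftrightarrow> k \<in> x"
      using y(1) by blast
  qed
  then show False
    using none \<open>A \<subseteq> x\<close> by blast
qed

theorem proposition2p13:
  fixes T :: "'a set" and r :: "'a rel"
  assumes "order_tree T r"
  shows "hereditarily_complete (ray_space T r) {rays_through T r t | t. t \<in> T}"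
  unfolding hereditarily_complete_def complete_collection_def
proof (intro allI impI, elim conjE)
  fix Y \<F>
  assume Y: "closedin (ray_space T r) Y"
    and sub: "\<F> \<subseteq> {S \<inter> Y | S. S \<in> {rays_through T r t | t. t \<in> T}}"
    and "\<F> \<noteq> {}" and "centered \<F>"
  have Y_rays: "Y \<subseteq> tree_rays T r"
    using closedin_subset[OF Y] by simp
  \<comment> \<open>Distinct nodes can have the same trace on \<open>Y\<close>; taking all of them
    makes \<open>\<F>\<close> the image of \<open>A\<close> without choosing
    representatives.\<close>
  define A where "A = {t \<in> T. rays_through T r t \<inter> Y \<in> \<F>}"
  have \<F>: "\<F> = (\<lambda>t. rays_through T r t \<inter> Y) ` A"
    using sub by (auto simp: A_def)
  have "\<exists>y\<in>Y. A \<subseteq> y"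
  proof (rule closed_rays_meet_all[OF _ Y])
    show "partial_order_on T r"
      using assms by (simp add: order_tree_def)
    show "A \<subseteq> T"
      by (auto simp: A_def)
    show "A \<noteq> {}"
      using \<F> \<open>\<F> \<noteq> {}\<close> by blast
    fix G assume G: "finite G" "G \<noteq> {}" "G \<subseteq> A"
    then have "(\<lambda>t. rays_through T r t \<inter> Y) ` G \<subseteq> \<F>"
      unfolding \<F> by (intro image_mono)
    then have "\<Inter> ((\<lambda>t. rays_through T r t \<inter> Y) ` G) \<noteq> {}"
      using \<open>centered \<F>\<close> G(1,2)
      unfolding centered_def by (meson finite_imageI image_is_empty)
    \<comment> \<open>As \<open>G\<close> is nonempty, a common point of these traces lies in
      \<open>Y\<close>.\<close>
    then show "\<exists>y\<in>Y. G \<subseteq> y"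
      using G(2) by (auto simp: rays_through_def)
  qed
  then show "\<Inter>\<F> \<noteq> {}"
    using Y_rays unfolding \<F> by (auto simp: rays_through_def)
qed

end
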